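(* Let $r>0$, let $a<b$ be real numbers, and let $f\in\Gamma_0(\mathbb{R})$ be differentiable on $[a,b]$. Define $g\in\Gamma_0(\mathbb{R})$ by $$g(x)=\begin{cases}f(x),&\text{if }a\le x\le b,\\ \infty,&\text{otherwise.}\end{cases}$$ Then $$P_rg(x)=\begin{cases}a,&\text{if }x\le a+\frac1rf'(a),\\ P_rf(x),&\text{if }a+\frac1rf'(a)<x<b+\frac1rf'(b),\\ b,&\text{if }b+\frac1rf'(b)\le x,\end{cases}$$ and $$e_rg(x)=\begin{cases}f(a)+\frac r2(a-x)^2,&\text{if }x\le a+\frac1rf'(a),\\ e_rf(x),&\text{if }a+\frac1rf'(a)<x<b+\frac1rf'(b),\\ f(b)+\frac r2(b-x)^2,&\text{if }b+\frac1rf'(b)\le x.\end{cases}$$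
   Context: $\Gamma_0(\mathbb{R})$ is the set of proper, convex, lower semicontinuous functions $f:\mathbb{R}\to\mathbb{R}\cup\{\infty\}$. For such $f$ and $r>0$, the Moreau envelope is $e_rf(x)=\inf_{y\in\mathbb{R}}\{f(y)+\frac r2(y-x)^2\}$ and the proximal mapping is $P_rf(x)=\operatorname{argmin}_{y\in\mathbb{R}}\{f(y)+\frac r2(y-x)^2\}$, a singleton identified with its unique element. *)

theory Defs
  imports "HOL-Analysis.Analysis"
begin

definition proper_fun :: "(real \<Rightarrow> ereal) \<Rightarrow> bool" where
  "proper_fun f \<longleftrightarrow> (\<forall>x. f x \<noteq> -\<infinity>) \<and> (\<exists>x. f x \<noteq> \<infinity>)"

text \<open>For functions that never take the value \<open>-\<infinity>\<close> no sum \<open>\<infinity> - \<infinity>\<close> arises here, and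
  \<open>0 * \<infinity> = 0\<close> in \<^typ>\<open>ereal\<close> makes the cases \<open>u = 0\<close> and \<open>v = 0\<close> trivial.\<close>

definition convex_fun :: "(real \<Rightarrow> ereal) \<Rightarrow> bool" where
  "convex_fun f \<longleftrightarrow>
    (\<forall>x y. \<forall>u\<ge>0. \<forall>v\<ge>0. u + v = 1 \<longrightarrow> f (u * x + v * y) \<le> ereal u * f x + ereal v * f y)"

definition lsc_fun :: "(real \<Rightarrow> ereal) \<Rightarrow> bool" where
  "lsc_fun f \<longleftrightarrow> (\<forall>x. f x \<le> Liminf (at x) f)"

definition Gamma0 :: "(real \<Rightarrow> ereal) set" where
  "Gamma0 = {f. proper_fun f \<and> convex_fun f \<and> lsc_fun f}"

definition prox_obj :: "real \<Rightarrow> (real \<Rightarrow> ereal) \<Rightarrow> real \<Rightarrow> real \<Rightarrow> ereal" where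
  "prox_obj r f x y = f y + ereal (r / 2 * (y - x)\<^sup>2)"

definition moreau :: "real \<Rightarrow> (real \<Rightarrow> ereal) \<Rightarrow> real \<Rightarrow> ereal" where
  "moreau r f x = (INF y. prox_obj r f x y)"

text \<open>The set of minimisers is a singleton whenever \<open>f \<in> Gamma0\<close> and \<open>r > 0\<close>; this is proved
  below as \<open>prox_ex1\<close>.\<close>

definition prox :: "real \<Rightarrow> (real \<Rightarrow> ereal) \<Rightarrow> real \<Rightarrow> real" where
  "prox r f x = (THE y. is_arg_min (prox_obj r f x) (\<lambda>_. True) y)"

lemma lsc_fun_eventually:
  assumes "lsc_fun f" "c < f s"
  shows "eventually (\<lambda>y. c < f y) (nhds s)"
proof -
  have "eventually (\<lambda>y. c < f y) (at s)"
    using assms unfolding lsc_fun_def le_Liminf_iff by blast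
  then show ?thesis
    using assms(2) unfolding eventually_at_filter by (auto elim: eventually_mono)
qed

lemma lsc_attains_min:
  fixes h :: "real \<Rightarrow> ereal"
  assumes lsc: "\<And>c s. c < h s \<Longrightarrow> eventually (\<lambda>y. c < h y) (nhds s)"
    and K: "compact K" "K \<noteq> {}"
  shows "\<exists>s\<in>K. \<forall>y\<in>K. h s \<le> h y"
proof (rule ccontr)
  assume "\<not> ?thesis"
  then have "\<forall>s\<in>K. \<exists>y\<in>K. h y < h s" by (meson not_le)
  then obtain w where w: "\<And>s. s \<in> K \<Longrightarrow> w s \<in> K \<and> h (w s) < h s" by metis
  then have "\<forall>s\<in>K. \<exists>U. open U \<and> s \<in> U \<and> (\<forall>y\<in>U. h (w s) < h y)"
    using lsc unfolding eventually_nhds by blast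
  then obtain U where U: "\<And>s. s \<in> K \<Longrightarrow> open (U s) \<and> s \<in> U s \<and> (\<forall>y\<in>U s. h (w s) < h y)"
    by metis
  obtain C where C: "C \<subseteq> K" "finite C" "K \<subseteq> (\<Union>s\<in>C. U s)"
    by (rule compactE_image[OF K(1), of K U]) (use U in auto)
  have "C \<noteq> {}" using C(3) K(2) by auto
  then obtain s where s: "s \<in> C" "\<And>t. t \<in> C \<Longrightarrow> h (w s) \<le> h (w t)"
    using arg_min_if_finite[OF C(2), of "\<lambda>t. h (w t)"] by (meson not_le)
  have "w s \<in> K" using s C w by blast
  then obtain t where t: "t \<in> C" "w s \<in> U t" using C by blast
  then have "h (w t) < h (w s)" using U C by blast
  then show False using s(2)[OF t(1)] by simp
qed

lemma prox_obj_lsc: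
  assumes "lsc_fun f" "proper_fun f" "c < prox_obj r f x s"
  shows "eventually (\<lambda>y. c < prox_obj r f x y) (nhds s)"
proof -
  define q where "q y = r / 2 * (y - x)\<^sup>2" for y
  have "\<exists>d. ereal d < f s \<and> c < ereal (d + q s)"
  proof (cases c)
    case (real c')
    then have "ereal (c' - q s) < f s"
      using assms(3) unfolding prox_obj_def q_def[symmetric] by (cases "f s") auto
    then obtain d where "ereal (c' - q s) < ereal d" "ereal d < f s"
      using ereal_dense2 by blast
    then show ?thesis using real by (intro exI[of _ d]) auto
  next
    case PInf
    then show ?thesis using assms(3) by auto
  next
    case MInf
    have "-\<infinity> < f s" using assms(2) by (simp add: proper_fun_def)
    then obtain d where "ereal d < f s" using ereal_dense2 by blast
    then show ?thesis using MInf by auto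
  qed
  then obtain d where d: "ereal d < f s" "c < ereal (d + q s)" by blast
  have 1: "eventually (\<lambda>y. ereal d < f y) (nhds s)"
    using lsc_fun_eventually assms(1) d(1) by blast
  have "((\<lambda>y. ereal (d + q y)) \<longlongrightarrow> ereal (d + q s)) (nhds s)"
    unfolding q_def by (intro tendsto_intros filterlim_ident)
  then have 2: "eventually (\<lambda>y. c < ereal (d + q y)) (nhds s)"
    using d(2) by (rule order_tendstoD)
  show ?thesis
    using 1 2
  proof eventually_elim
    case (elim y)
    have "ereal (d + q y) \<le> f y + ereal (q y)"
      using elim(1) by (cases "f y") auto
    then show ?case using elim(2) by (simp add: prox_obj_def q_def)
  qed
qed

lemma prox_obj_attains_min:
  assumes f: "f \<in> Gamma0" and r: "r > 0"
  shows "\<exists>s. \<forall>y. prox_obj r f x s \<le> prox_obj r f x y"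
proof -
  have pr: "proper_fun f" and cv: "convex_fun f" and lsc: "lsc_fun f"
    using f by (auto simp: Gamma0_def)
  have nm: "f y \<noteq> -\<infinity>" for y using pr by (simp add: proper_fun_def)
  obtain y0 where "f y0 \<noteq> \<infinity>" using pr by (auto simp: proper_fun_def)
  then obtain F where F: "f y0 = ereal F" using nm by (cases "f y0") auto
  obtain s0 where s0: "s0 \<in> {y0-1..y0+1}" "\<forall>y\<in>{y0-1..y0+1}. f s0 \<le> f y"
    using lsc_attains_min[of f "{y0-1..y0+1}"] lsc_fun_eventually[OF lsc] by auto
  have "f s0 \<le> ereal F" using s0(2)[rule_format, of y0] F by simp
  then obtain m where m: "f s0 = ereal m" "m \<le> F" using nm[of s0] by (cases "f s0") auto
  define R where "R = 2 * (F - m) / r + 2 * \<bar>y0 - x\<bar> + 1"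
  have R: "R \<ge> 1" using m r by (simp add: R_def)
  have far: "prox_obj r f x y0 \<le> prox_obj r f x y" if y: "\<bar>y - y0\<bar> \<ge> R" for y
  proof (cases "f y")
    case (real fy)
    define d where "d = \<bar>y - y0\<bar>"
    have d: "d \<ge> 1" "d \<ge> R" using y R by (auto simp: d_def)
    define z where "z = (1 - 1/d) * y0 + (1/d) * y"
    have "z - y0 = (y - y0) / d" using d by (simp add: z_def field_simps)
    then have "\<bar>z - y0\<bar> = 1" using d by (simp add: d_def)
    then have "z \<in> {y0-1..y0+1}" by auto
    then have "ereal m \<le> f z" using s0 m by metis
    also have "f z \<le> ereal (1 - 1/d) * f y0 + ereal (1/d) * f y"
      unfolding z_def using d by (intro cv[unfolded convex_fun_def, rule_format]) auto
    finally have "m \<le> (1 - 1/d) * F + (1/d) * fy" using F real by simp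
    then have "d * m \<le> d * ((1 - 1/d) * F + (1/d) * fy)"
      using d by (intro mult_left_mono) auto
    also have "\<dots> = d * F - F + fy" using d by (simp add: field_simps)
    finally have fy: "fy \<ge> F - (F - m) * d" by (simp add: algebra_simps)
    have "(y - x)\<^sup>2 - (y0 - x)\<^sup>2 = d\<^sup>2 + 2 * ((y - y0) * (y0 - x))"
      by (simp add: d_def power2_eq_square algebra_simps)
    moreover have "(y - y0) * (y0 - x) \<ge> - (d * \<bar>y0 - x\<bar>)"
      by (metis abs_ge_minus_self abs_mult d_def minus_le_iff)
    ultimately have "(y - x)\<^sup>2 - (y0 - x)\<^sup>2 \<ge> d * (d - 2 * \<bar>y0 - x\<bar>)"
      by (simp add: power2_eq_square algebra_simps)
    moreover have "d * (d - 2 * \<bar>y0 - x\<bar>) \<ge> d * (2 * (F - m) / r)"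
      using d by (intro mult_left_mono) (auto simp: R_def)
    ultimately have "r / 2 * ((y - x)\<^sup>2 - (y0 - x)\<^sup>2) \<ge> r / 2 * (d * (2 * (F - m) / r))"
      using r by (intro mult_left_mono) auto
    moreover have "r / 2 * (d * (2 * (F - m) / r)) = d * (F - m)" using r by simp
    ultimately have "r / 2 * (y - x)\<^sup>2 - r / 2 * (y0 - x)\<^sup>2 \<ge> d * (F - m)"
      by (simp only: right_diff_distrib)
    then show ?thesis using fy F real by (simp add: prox_obj_def algebra_simps)
  next
    case PInf
    then show ?thesis by (simp add: prox_obj_def)
  qed (use nm in auto)
  obtain s where s: "\<forall>y\<in>{y0-R..y0+R}. prox_obj r f x s \<le> prox_obj r f x y"
    using lsc_attains_min[of "prox_obj r f x" "{y0-R..y0+R}"] prox_obj_lsc[OF lsc pr] R by auto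
  have "prox_obj r f x s \<le> prox_obj r f x y" for y
  proof (cases "y \<in> {y0-R..y0+R}")
    case False
    then have "\<bar>y - y0\<bar> \<ge> R" by auto
    moreover have "prox_obj r f x s \<le> prox_obj r f x y0" using s R by auto
    ultimately show ?thesis using far order_trans by blast
  qed (use s in auto)
  then show ?thesis by blast
qed

lemma prox_ex1:
  assumes f: "f \<in> Gamma0" and r: "r > 0"
  shows "\<exists>!y. is_arg_min (prox_obj r f x) (\<lambda>_. True) y"
proof -
  have pr: "proper_fun f" and cv: "convex_fun f" using f by (auto simp: Gamma0_def)
  have nm: "f y \<noteq> -\<infinity>" for y using pr by (simp add: proper_fun_def)
  obtain y0 where y0: "f y0 \<noteq> \<infinity>" using pr by (auto simp: proper_fun_def)
  have fin: "f u \<noteq> \<infinity>" if "\<forall>y. prox_obj r f x u \<le> prox_obj r f x y" for u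
    using that[rule_format, of y0] y0 nm[of y0] by (cases "f y0") (auto simp: prox_obj_def)
  have uniq: "u = v" if u: "\<forall>y. prox_obj r f x u \<le> prox_obj r f x y"
    and v: "\<forall>y. prox_obj r f x v \<le> prox_obj r f x y" for u v
  proof (rule ccontr)
    assume "u \<noteq> v"
    then have pos: "r / 8 * (u - v)\<^sup>2 > 0" using r by simp
    obtain a b where ab: "f u = ereal a" "f v = ereal b"
      using fin[OF u] fin[OF v] nm[of u] nm[of v] by (cases "f u"; cases "f v") auto
    define z where "z = 1/2 * u + 1/2 * v"
    have cz: "f z \<le> ereal (1/2) * f u + ereal (1/2) * f v"
      using cv[unfolded convex_fun_def, rule_format, of "1/2" "1/2" u v] by (simp add: z_def)
    then obtain c where c: "f z = ereal c" using nm[of z] ab by (cases "f z") auto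
    have "c \<le> a / 2 + b / 2" using cz ab c by simp
    moreover have "a + r / 2 * (u - x)\<^sup>2 \<le> c + r / 2 * (z - x)\<^sup>2"
      using u[rule_format, of z] ab c by (simp add: prox_obj_def)
    moreover have "b + r / 2 * (v - x)\<^sup>2 \<le> c + r / 2 * (z - x)\<^sup>2"
      using v[rule_format, of z] ab c by (simp add: prox_obj_def)
    moreover have "r / 2 * (z - x)\<^sup>2
        = (r / 2 * (u - x)\<^sup>2) / 2 + (r / 2 * (v - x)\<^sup>2) / 2 - r / 8 * (u - v)\<^sup>2"
      by (simp add: z_def power2_eq_square field_simps)
    ultimately show False using pos by linarith
  qed
  show ?thesis
    using prox_obj_attains_min[OF f r, of x] uniq by (auto simp: is_arg_min_linorder)
qed

end

theory Submission
  imports Defs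
begin

text \<open>A one-sided derivative of a convex function is a subgradient. At the left endpoint,
  \<open>f' a\<close> is the right derivative, so \<open>f w \<ge> f a + f' a * (w - a)\<close> for all real \<open>w\<close>, and the
  objective at \<open>w\<close> exceeds that at \<open>a\<close> by at least
  \<open>(w - a) * (f' a + r * (a - x)) + r / 2 * (w - a)\<^sup>2\<close>. When \<open>f' a + r * (a - x)\<close> is
  nonnegative this makes \<open>a\<close> optimal among the \<open>w \<ge> a\<close>; when it is negative it excludes
  minimisers of the objective of \<open>f\<close> to the left of \<open>a\<close>. The endpoint \<open>b\<close> is treated in the
  same way, and in the middle case the minimiser for \<open>f\<close> lies in \<open>[a, b]\<close>.\<close>

lemma convex_fun_real:
  assumes "convex_fun f" "u \<ge> 0" "v \<ge> 0" "u + v = 1"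
    and "f x = ereal X" "f y = ereal Y" "f (u * x + v * y) = ereal Z"
  shows "Z \<le> u * X + v * Y"
  using assms(1)[unfolded convex_fun_def, rule_format, of u v x y] assms by simp

text \<open>Convexity bounds every difference quotient taken from \<open>c\<close> into the segment
  by the chord from \<open>c\<close> to \<open>w\<close>, and the bound survives the limit. Stating
  it with \<open>closed_segment c d\<close> and no order between \<open>c\<close> and
  \<open>d\<close> lets one proof serve both a left and a right endpoint.\<close>

lemma convex_fun_subgradient:
  assumes cv: "convex_fun f" and nm: "\<And>y. f y \<noteq> -\<infinity>"
    and fin: "\<And>y. y \<in> closed_segment c d \<Longrightarrow> f y \<noteq> \<infinity>" and cd: "c \<noteq> d"
    and der: "((\<lambda>y. real_of_ereal (f y)) has_real_derivative D) (at c within closed_segment c d)"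
  shows "f c + ereal (D * (w - c)) \<le> f w"
proof (cases "f w")
  case (real W)
  define F where "F y = real_of_ereal (f y)" for y
  have F: "f y = ereal (F y)" if "y \<in> closed_segment c d" for y
    using nm[of y] fin[OF that] by (cases "f y") (auto simp: F_def)
  have Fc: "f c = ereal (F c)" using F by simp
  \<comment> \<open>\<open>k\<close> is the coordinate of \<open>w\<close> on the line with
    \<open>c\<close> at 0 and \<open>d\<close> at 1. In this parameter the derivative at
    \<open>c\<close> is a right derivative at 0, whichever way the segment points.\<close>
  define k where "k = (w - c) / (d - c)"
  have w: "w = c + k * (d - c)" using cd by (simp add: k_def)
  define z where "z t = c + t * (d - c)" for t
  have seg: "z t \<in> closed_segment c d" if "t \<in> {0..1}" for t
    using that by (auto simp: z_def in_segment algebra_simps intro!: exI[of _ t])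
  have "(F has_real_derivative D) (at (z 0) within z ` {0..1})"
    by (rule DERIV_subset[of _ _ _ "closed_segment c d"])
      (use der seg in \<open>auto simp: z_def F_def[abs_def]\<close>)
  moreover have "(z has_real_derivative (d - c)) (at 0 within {0..1})"
    unfolding z_def by (auto intro!: derivative_eq_intros)
  ultimately have "(F \<circ> z has_real_derivative D * (d - c)) (at 0 within {0..1})"
    by (rule DERIV_image_chain)
  then have "((\<lambda>t. (F (z t) - F c) / t) \<longlongrightarrow> D * (d - c)) (at 0 within {0..1})"
    by (simp add: has_field_derivative_iff z_def)
  then have lim: "((\<lambda>t. k * ((F (z t) - F c) / t)) \<longlongrightarrow> k * (D * (d - c))) (at 0 within {0..1})"
    by (rule tendsto_mult_left)
  \<comment> \<open>For \<open>k > 0\<close> the bound \<open>t < \<bar>k\<bar>\<close> puts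
    \<open>z t\<close> between \<open>c\<close> and \<open>w\<close>; for \<open>k < 0\<close> the
    point \<open>c\<close> lies between \<open>w\<close> and \<open>z t\<close>. Either way
    convexity is applied at the middle point of the three.\<close>
  have slope: "k * ((F (z t) - F c) / t) \<le> W - F c"
    if t: "0 < t" "t \<le> 1" "t < \<bar>k\<bar> \<or> k = 0" for t
  proof -
    have Fz: "f (z t) = ereal (F (z t))" using F seg t by auto
    consider "k = 0" | "k > 0" | "k < 0" by linarith
    then show ?thesis
    proof cases
      case 1
      then show ?thesis using w real Fc by simp
    next
      case 2
      have "(1 - t / k) * c + (t / k) * w = z t" using 2 by (simp add: w z_def field_simps)
      then have "F (z t) \<le> (1 - t / k) * F c + (t / k) * W"
        using t 2 Fc Fz real by (intro convex_fun_real[OF cv]) auto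
      then show ?thesis using t 2 by (simp add: field_simps)
    next
      case 3
      have "(t / (t - k)) * w + (- k / (t - k)) * z t = c"
        using t 3 by (simp add: w z_def divide_simps) (simp add: algebra_simps)
      then have "F c \<le> (t / (t - k)) * W + (- k / (t - k)) * F (z t)"
        using t 3 Fc Fz real
        by (intro convex_fun_real[OF cv]) (auto simp: divide_simps)
      also have "\<dots> = (t * W - k * F (z t)) / (t - k)"
        by (simp add: diff_divide_distrib)
      finally have "F c * (t - k) \<le> t * W - k * F (z t)"
        using t 3 by (simp add: pos_le_divide_eq)
      then show ?thesis using t by (simp add: field_simps)
    qed
  qed
  \<comment> \<open>The upper bound has to be positive for \<open>t\<close> tending to 0 to fall
    below it; the value 1 stands in for \<open>\<bar>k\<bar>\<close> when
    \<open>k = 0\<close>.\<close>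
  have "eventually (\<lambda>t. t < (if k = 0 then 1 else \<bar>k\<bar>)) (at (0::real) within {0..1})"
    by (rule order_tendstoD[OF tendsto_ident_at]) auto
  moreover have "eventually (\<lambda>t. t \<in> {0..1} \<and> t \<noteq> 0) (at (0::real) within {0..1})"
    by (auto simp: eventually_at_filter)
  ultimately have ev: "eventually (\<lambda>t. k * ((F (z t) - F c) / t) \<le> W - F c) (at 0 within {0..1})"
    by eventually_elim (rule slope; auto split: if_splits)
  have "at (0::real) within {0..1} \<noteq> bot"
    by (simp add: at_within_Icc_at_right)
  with lim ev have "k * (D * (d - c)) \<le> W - F c" by (rule tendsto_upperbound)
  moreover have "k * (D * (d - c)) = D * (w - c)" by (simp add: w)
  ultimately show ?thesis using Fc real by simp
qed (use nm in auto)

text \<open>Expanding the quadratic around \<open>c\<close> is exact: its slope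
  \<open>r * (c - x)\<close> joins the subgradient \<open>D\<close>, and the remainder
  \<open>r / 2 * (w - c)\<^sup>2\<close> is kept as a strict gain.\<close>

lemma prox_obj_subgradient:
  assumes "f c + ereal (D * (w - c)) \<le> f w"
  shows "prox_obj r f x c + ereal ((w - c) * (D + r * (c - x)) + r / 2 * (w - c)\<^sup>2)
    \<le> prox_obj r f x w"
proof -
  have "(w - c) * (D + r * (c - x)) + r / 2 * (w - c)\<^sup>2
      = D * (w - c) + (r / 2 * (w - x)\<^sup>2 - r / 2 * (c - x)\<^sup>2)"
    by (simp add: power2_eq_square field_simps)
  then show ?thesis
    using assms unfolding prox_obj_def by (cases "f c"; cases "f w") auto
qed

lemma prox_minimiser:
  assumes "f \<in> Gamma0" "r > 0"
  shows "prox_obj r f x (prox r f x) \<le> prox_obj r f x y"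
  using theI'[OF prox_ex1[OF assms, of x]] by (auto simp: prox_def is_arg_min_linorder)

lemma prox_eqI:
  assumes "f \<in> Gamma0" "r > 0" "\<And>y. prox_obj r f x p \<le> prox_obj r f x y"
  shows "prox r f x = p"
  unfolding prox_def
  by (rule the1_equality[OF prox_ex1[OF assms(1,2)]]) (use assms(3) in \<open>simp add: is_arg_min_linorder\<close>)

lemma moreau_eqI:
  assumes "\<And>y. prox_obj r f x p \<le> prox_obj r f x y"
  shows "moreau r f x = prox_obj r f x p"
  unfolding moreau_def using assms by (intro antisym INF_greatest INF_lower) auto

text \<open>\<open>g\<close> is \<open>f\<close> plus the indicator of a closed convex set, so
  convexity and lower semicontinuity carry over; the point \<open>c\<close> keeps it proper.\<close>

lemma Gamma0_restrict_Icc: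
  assumes f: "f \<in> Gamma0" and c: "c \<in> {a..b}" "f c \<noteq> \<infinity>"
    and g: "\<And>x. g x = (if a \<le> x \<and> x \<le> b then f x else \<infinity>)"
  shows "g \<in> Gamma0"
proof -
  have cv: "convex_fun f" and lsc: "lsc_fun f" and nm: "\<And>y. f y \<noteq> -\<infinity>"
    using f by (auto simp: Gamma0_def proper_fun_def)
  have gnm: "g y \<noteq> -\<infinity>" for y using nm by (simp add: g)
  have "g c \<noteq> \<infinity>" using c by (simp add: g)
  then have "proper_fun g" using gnm by (auto simp: proper_fun_def)
  moreover have "convex_fun g"
    unfolding convex_fun_def
  proof (intro allI impI)
    fix x y u v :: real
    assume uv: "0 \<le> u" "0 \<le> v" "u + v = 1"
    \<comment> \<open>Zero weights are split off because \<open>0 * \<infinity> = 0\<close>: a point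
      outside the interval makes the right-hand side infinite only if its weight is
      positive.\<close>
    consider "u = 0" | "v = 0" | "u > 0" "v > 0" "x \<in> {a..b}" "y \<in> {a..b}"
      | "u > 0" "v > 0" "x \<notin> {a..b} \<or> y \<notin> {a..b}"
      using uv by fastforce
    then show "g (u * x + v * y) \<le> ereal u * g x + ereal v * g y"
    proof cases
      case 3
      have "u * x + v * y \<in> {a..b}"
        using convexD[OF convex_real_interval(5) 3(3,4) uv] by simp
      then show ?thesis
        using 3 cv uv by (auto simp: g convex_fun_def)
    next
      case 4
      then have "ereal u * g x + ereal v * g y = \<infinity>"
        using gnm[of x] gnm[of y] by (cases "g x"; cases "g y") (auto simp: g split: if_splits)
      then show ?thesis by (simp only: ereal_less_eq(1))
    qed (use uv in \<open>auto simp: zero_ereal_def[symmetric] one_ereal_def[symmetric]\<close>)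
  qed
  moreover have "lsc_fun g"
    unfolding lsc_fun_def
  proof
    fix x
    show "g x \<le> Liminf (at x) g"
    proof (cases "x \<in> {a..b}")
      case True
      then have "g x \<le> Liminf (at x) f" using lsc by (simp add: g lsc_fun_def)
      also have "\<dots> \<le> Liminf (at x) g"
        by (intro Liminf_mono always_eventually) (simp add: g)
      finally show ?thesis .
    next
      case False
      \<comment> \<open>The complement of the closed interval is open, so \<open>g\<close> is
        constantly \<open>\<infinity>\<close> near \<open>x\<close>.\<close>
      then have "eventually (\<lambda>y. y \<in> - {a..b}) (at x)"
        by (intro eventually_at_in_open') (auto intro: open_Compl)
      then have "eventually (\<lambda>y. \<infinity> \<le> g y) (at x)"
        by eventually_elim (auto simp: g)
      then have "\<infinity> \<le> Liminf (at x) g" by (rule Liminf_bounded)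
      then show ?thesis by simp
    qed
  qed
  ultimately show ?thesis by (simp add: Gamma0_def)
qed

theorem theorem3p16:
  fixes r a b :: real and f g :: "real \<Rightarrow> ereal" and f' :: "real \<Rightarrow> real"
  assumes "r > 0" and "a < b" and "f \<in> Gamma0"
    and "\<And>x. x \<in> {a..b} \<Longrightarrow> f x \<noteq> \<infinity>"
    and "\<And>x. x \<in> {a..b} \<Longrightarrow>
           ((\<lambda>y. real_of_ereal (f y)) has_real_derivative f' x) (at x within {a..b})"
    and "\<And>x. g x = (if a \<le> x \<and> x \<le> b then f x else \<infinity>)"
  shows "g \<in> Gamma0 \<and>
    (\<forall>x.
      (x \<le> a + 1 / r * f' a \<longrightarrow> prox r g x = a) \<and>
      (a + 1 / r * f' a < x \<and> x < b + 1 / r * f' b \<longrightarrow> prox r g x = prox r f x) \<and>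
      (b + 1 / r * f' b \<le> x \<longrightarrow> prox r g x = b)) \<and>
    (\<forall>x.
      (x \<le> a + 1 / r * f' a \<longrightarrow> moreau r g x = f a + ereal (r / 2 * (a - x)\<^sup>2)) \<and>
      (a + 1 / r * f' a < x \<and> x < b + 1 / r * f' b \<longrightarrow> moreau r g x = moreau r f x) \<and>
      (b + 1 / r * f' b \<le> x \<longrightarrow> moreau r g x = f b + ereal (r / 2 * (b - x)\<^sup>2)))"
proof -
  note r = \<open>r > 0\<close> and ab = \<open>a < b\<close> and f = \<open>f \<in> Gamma0\<close> and fin = assms(4) and der = assms(5)
    and g = assms(6)
  have cv: "convex_fun f" and nm: "\<And>y. f y \<noteq> -\<infinity>"
    using f by (auto simp: Gamma0_def proper_fun_def)
  have G: "g \<in> Gamma0"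
    using Gamma0_restrict_Icc[OF f _ _ g, of a] fin ab by simp
  \<comment> \<open>\<open>A x\<close> and \<open>B x\<close> are the slopes of the objective of
    \<open>f\<close> at \<open>a\<close> and \<open>b\<close>, taken from inside the interval. Their
    signs encode the thresholds of the statement.\<close>
  define A where "A x = f' a + r * (a - x)" for x
  define B where "B x = f' b + r * (b - x)" for x
  have A: "x \<le> a + 1 / r * f' a \<longleftrightarrow> A x \<ge> 0" for x
    using r by (simp add: A_def field_simps)
  have B: "b + 1 / r * f' b \<le> x \<longleftrightarrow> B x \<le> 0" for x
    using r by (simp add: B_def field_simps)
  have A': "a + 1 / r * f' a < x \<longleftrightarrow> A x < 0" and B': "x < b + 1 / r * f' b \<longleftrightarrow> B x > 0" for x
    using A[of x] B[of x] by linarith+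
  have "f a + ereal (f' a * (w - a)) \<le> f w" for w
    using fin der[of a] ab
    by (intro convex_fun_subgradient[OF cv nm, of a b]) (auto simp: closed_segment_eq_real_ivl)
  then have subA: "prox_obj r f x a + ereal ((w - a) * A x + r / 2 * (w - a)\<^sup>2) \<le> prox_obj r f x w"
    for x w unfolding A_def by (rule prox_obj_subgradient)
  have "f b + ereal (f' b * (w - b)) \<le> f w" for w
    using fin der[of b] ab
    by (intro convex_fun_subgradient[OF cv nm, of b a]) (auto simp: closed_segment_eq_real_ivl)
  then have subB: "prox_obj r f x b + ereal ((w - b) * B x + r / 2 * (w - b)\<^sup>2) \<le> prox_obj r f x w"
    for x w unfolding B_def by (rule prox_obj_subgradient)
  have gmin: "prox_obj r g x p \<le> prox_obj r g x y"
    if "p \<in> {a..b}" "\<And>y. y \<in> {a..b} \<Longrightarrow> prox_obj r f x p \<le> prox_obj r f x y" for x p y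
    using that by (cases "y \<in> {a..b}") (auto simp: prox_obj_def g)
  have minA: "prox_obj r g x a \<le> prox_obj r g x y" if "A x \<ge> 0" for x y
  proof (rule gmin)
    fix w assume "w \<in> {a..b}"
    then have "0 \<le> ereal ((w - a) * A x + r / 2 * (w - a)\<^sup>2)" using that r by simp
    then show "prox_obj r f x a \<le> prox_obj r f x w"
      using subA by (rule order_trans[OF ereal_le_add_self])
  qed (use ab in simp)
  have minB: "prox_obj r g x b \<le> prox_obj r g x y" if "B x \<le> 0" for x y
  proof (rule gmin)
    fix w assume "w \<in> {a..b}"
    then have "0 \<le> ereal ((w - b) * B x + r / 2 * (w - b)\<^sup>2)" using that r by (simp add: mult_nonpos_nonpos)
    then show "prox_obj r f x b \<le> prox_obj r f x w"
      using subB by (rule order_trans[OF ereal_le_add_self])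
  qed (use ab in simp)
  have mid: "prox r f x \<in> {a..b}" if AB: "A x < 0" "B x > 0" for x
  proof -
    define p where "p = prox r f x"
    have p: "prox_obj r f x p \<le> prox_obj r f x y" for y
      unfolding p_def using f r by (rule prox_minimiser)
    \<comment> \<open>No value exceeds the minimum at \<open>p\<close> by a positive
      \<open>e\<close> and still stays below it; finiteness of \<open>f c\<close> allows the
      cancellation.\<close>
    have excl: "e \<le> 0" if "c \<in> {a..b}" "prox_obj r f x c + ereal e \<le> prox_obj r f x p" for c e
    proof -
      have "prox_obj r f x c + ereal e \<le> prox_obj r f x c" using that(2) p order_trans by blast
      then show ?thesis
        using nm[of c] fin[OF that(1)] by (cases "f c") (auto simp: prox_obj_def)
    qed
    have "a \<le> p"
    proof (rule ccontr)
      assume "\<not> a \<le> p"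
      \<comment> \<open>Both factors \<open>p - a\<close> and \<open>A x\<close> are negative, so
        the objective at \<open>p\<close> would strictly exceed that at \<open>a\<close>.\<close>
      then have "(p - a) * A x + r / 2 * (p - a)\<^sup>2 > 0"
        using AB r by (intro add_pos_pos mult_neg_neg mult_pos_pos) auto
      then show False using excl[OF _ subA] ab by fastforce
    qed
    moreover have "p \<le> b"
    proof (rule ccontr)
      assume "\<not> p \<le> b"
      then have "(p - b) * B x + r / 2 * (p - b)\<^sup>2 > 0"
        using AB r by (intro add_pos_pos mult_pos_pos) auto
      then show False using excl[OF _ subB] ab by fastforce
    qed
    ultimately show ?thesis by (simp add: p_def)
  qed
  have minM: "prox_obj r g x (prox r f x) \<le> prox_obj r g x y" if "A x < 0" "B x > 0" for x y
    using mid[OF that] prox_minimiser[OF f r] by (rule gmin)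
  \<comment> \<open>The minimiser for \<open>f\<close> lies in \<open>[a, b]\<close>, where
    \<open>f\<close> and \<open>g\<close> agree, and it also minimises the objective of
    \<open>g\<close>; hence the two minimal values coincide.\<close>
  have "moreau r g x = moreau r f x" if AB: "A x < 0" "B x > 0" for x
    using moreau_eqI[OF minM[OF AB]] moreau_eqI[OF prox_minimiser[OF f r]] mid[OF AB]
    by (simp add: prox_obj_def g)
  moreover have "moreau r g x = f a + ereal (r / 2 * (a - x)\<^sup>2)" if "A x \<ge> 0" for x
    using moreau_eqI[OF minA[OF that]] ab by (simp add: prox_obj_def g)
  moreover have "moreau r g x = f b + ereal (r / 2 * (b - x)\<^sup>2)" if "B x \<le> 0" for x
    using moreau_eqI[OF minB[OF that]] ab by (simp add: prox_obj_def g)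
  ultimately show ?thesis
    using G prox_eqI[OF G r minA] prox_eqI[OF G r minB] prox_eqI[OF G r minM]
    unfolding A B A' B' by blast
qed

end
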